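(* Let $k \geq 2$ be an integer and let $G=(D\cup I,E)$ be a split graph. If $G$ has $k$ completely independent spanning trees, then the corresponding hypergraph $H(G)$ admits a panchromatic $k$-coloring.
   Context: All graphs are finite, simple and undirected. A split graph $G=(D\cup I,E)$ is a graph whose vertex set is partitioned into a clique $D$ and an independent set $I$; the paper assumes throughout that every vertex of $D$ is adjacent to at least one vertex of $I$. Its corresponding hypergraph is $H(G)=(D,\mathcal{E})$ with $\mathcal{E}=\{N_G(x) : x\in I\}$, where $N_G(x)$ is the neighborhood of $x$ in $G$ (one hyperedge $e_x=N_G(x)$ for each $x\in I$). A panchromatic $k$-coloring of a hypergraph is an assignment of colors from $\{1,\dots,k\}$ to its vertices such that every hyperedge contains at least one vertex of each of the $k$ colors. Spanning trees $T_1,\dots,T_k$ of a graph $G$ are completely independent spanning trees (CIST) if for every pair of vertices $x,y$ the $(x,y)$-paths in $T_1,\dots,T_k$ are pairwise openly-disjoint, i.e. pairwise edge-disjoint and with no common internal vertex. *)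

theory Defs
  imports "Graph_Theory.Graph_Theory"
begin

text \<open>
  Finite simple undirected graphs are the \<^locale>\<open>pair_graph\<close>s: finite, loop-free digraphs
  without parallel arcs whose arc relation is symmetric. An undirected edge \<open>uv\<close> is thus present
  as the two arcs \<open>(u, v)\<close> and \<open>(v, u)\<close>.
\<close>

definition neighborhood :: "'a pair_pre_digraph \<Rightarrow> 'a \<Rightarrow> 'a set" where
  "neighborhood G x = {y. (x, y) \<in> parcs G}"

text \<open>
  As usual for partitions, both parts are non-empty. For \<open>D = {}\<close> the graph could be a single
  vertex, which vacuously has any number of completely independent spanning trees, while its
  hypergraph has no vertices and the empty set as a hyperedge.
\<close>

definition split_graph :: "'a pair_pre_digraph \<Rightarrow> 'a set \<Rightarrow> 'a set \<Rightarrow> bool" where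
  "split_graph G D I \<longleftrightarrow>
     pair_graph G \<and>
     pverts G = D \<union> I \<and> D \<inter> I = {} \<and> D \<noteq> {} \<and> I \<noteq> {} \<and>
     (\<forall>u\<in>D. \<forall>v\<in>D. u \<noteq> v \<longrightarrow> (u, v) \<in> parcs G) \<and>
     (\<forall>u\<in>I. \<forall>v\<in>I. (u, v) \<notin> parcs G)"

record 'a hypergraph =
  hverts :: "'a set"
  hedges :: "'a set set"

definition split_hypergraph :: "'a pair_pre_digraph \<Rightarrow> 'a set \<Rightarrow> 'a set \<Rightarrow> 'a hypergraph" where
  "split_hypergraph G D I = \<lparr> hverts = D, hedges = neighborhood G ` I \<rparr>"

definition panchromatic_coloring :: "nat \<Rightarrow> 'a hypergraph \<Rightarrow> ('a \<Rightarrow> nat) \<Rightarrow> bool" where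
  "panchromatic_coloring k H c \<longleftrightarrow>
     c ` hverts H \<subseteq> {1..k} \<and> (\<forall>e\<in>hedges H. \<forall>j\<in>{1..k}. \<exists>v\<in>e. c v = j)"

text \<open>
  The library's \<^const>\<open>tree\<close> and \<^const>\<open>spanning_tree\<close> do not describe undirected trees:
  \<^const>\<open>forest\<close> excludes directed cycles, so no symmetric digraph with an edge is a \<^const>\<open>tree\<close>
  (\<open>u, v, u\<close> is a directed cycle), whereas a transitively oriented triangle is one. In a
  \<^locale>\<open>pair_graph\<close>, the cycles of the undirected graph are the directed cycles of length at
  least 3.
\<close>

definition undirected_tree :: "'a pair_pre_digraph \<Rightarrow> bool" where
  "undirected_tree T \<longleftrightarrow>
     pair_graph T \<and> connected (with_proj T) \<and>
     \<not> (\<exists>p. pre_digraph.cycle (with_proj T) p \<and> length p \<ge> 3)"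

definition undirected_spanning_tree :: "'a pair_pre_digraph \<Rightarrow> 'a pair_pre_digraph \<Rightarrow> bool" where
  "undirected_spanning_tree T G \<longleftrightarrow> undirected_tree T \<and> spanning (with_proj T) (with_proj G)"

text \<open>
  Paths are lists of arcs. Edge-disjointness concerns undirected edges, so two paths using the same
  edge in opposite directions are not edge-disjoint.
\<close>

definition undirected_edges :: "('a \<times> 'a) awalk \<Rightarrow> 'a set set" where
  "undirected_edges p = (\<lambda>(u, v). {u, v}) ` set p"

definition completely_independent_spanning_trees ::
    "'a pair_pre_digraph \<Rightarrow> nat \<Rightarrow> (nat \<Rightarrow> 'a pair_pre_digraph) \<Rightarrow> bool" where
  "completely_independent_spanning_trees G k T \<longleftrightarrow>
     (\<forall>i\<in>{1..k}. undirected_spanning_tree (T i) G) \<and>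
     (\<forall>x\<in>pverts G. \<forall>y\<in>pverts G. \<forall>i\<in>{1..k}. \<forall>j\<in>{1..k}. i \<noteq> j \<longrightarrow>
        (\<forall>p q. pre_digraph.apath (with_proj (T i)) x p y \<longrightarrow>
               pre_digraph.apath (with_proj (T j)) x q y \<longrightarrow>
               undirected_edges p \<inter> undirected_edges q = {} \<and>
               set (pre_digraph.inner_verts (with_proj (T i)) p) \<inter>
               set (pre_digraph.inner_verts (with_proj (T j)) q) = {}))"

end

theory Submission
  imports Defs
begin

text \<open>
  Colour each vertex of \<open>D\<close> by the tree in which it has degree at least 2. There is at most one such
  tree: deleting \<open>v\<close> disconnects every tree in which \<open>v\<close> has degree at least 2, and the complement
  of a disconnected graph is connected, so if two trees were disconnected by \<open>v\<close>, some pair of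
  vertices would be separated in both and \<open>v\<close> would be a common inner vertex of the two paths.
  Every \<open>x \<in> I\<close> has a neighbour of degree at least 2 in each tree: otherwise the tree is a star
  centred at \<open>x\<close> containing all edges at \<open>x\<close>, and a second tree cannot reach \<open>x\<close> without sharing
  an edge with it.
\<close>

definition internal_vertex :: "'a pair_pre_digraph \<Rightarrow> 'a \<Rightarrow> bool" where
  "internal_vertex T v \<longleftrightarrow> (\<exists>a b. a \<noteq> b \<and> (v, a) \<in> parcs T \<and> (v, b) \<in> parcs T)"

text \<open>For vertices other than \<open>v\<close>, this says that \<open>u\<close> and
  \<open>w\<close> lie in the same component after deleting \<open>v\<close>. Walks rather than
  paths are used so that transitivity is plain concatenation.\<close>

definition (in pair_pre_digraph) connected_avoiding :: "'a \<Rightarrow> 'a \<Rightarrow> 'a \<Rightarrow> bool" where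
  "connected_avoiding v u w \<longleftrightarrow> (\<exists>p. awalk u p w \<and> v \<notin> set (awalk_verts u p))"

lemma (in pair_sym_digraph) connected_avoiding_sym:
  assumes "connected_avoiding v u w"
  shows "connected_avoiding v w u"
proof -
  obtain p where p: "awalk u p w" "v \<notin> set (awalk_verts u p)"
    using assms unfolding connected_avoiding_def by blast
  have "awalk w (rev_path p) u" "v \<notin> set (awalk_verts w (rev_path p))"
    using p awalk_verts_rev_path[OF p(1)] by auto
  then show ?thesis unfolding connected_avoiding_def by blast
qed

lemma (in pair_wf_digraph) connected_avoiding_trans:
  assumes "connected_avoiding v u w" "connected_avoiding v w x"
  shows "connected_avoiding v u x"
proof -
  obtain p q where "awalk u p w" "v \<notin> set (awalk_verts u p)"
    "awalk w q x" "v \<notin> set (awalk_verts w q)"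
    using assms unfolding connected_avoiding_def by blast
  then have "awalk u (p @ q) x" "v \<notin> set (awalk_verts u (p @ q))"
    using set_awalk_verts_append[of u p w q x] by (auto intro: awalk_appendI)
  then show ?thesis unfolding connected_avoiding_def by blast
qed

text \<open>\<open>connected\<close> ignores arc directions; since arcs come in symmetric pairs, it
  still yields directed reachability.\<close>

lemma undirected_tree_reachable:
  assumes "undirected_tree T" "u \<in> pverts T" "w \<in> pverts T"
  shows "u \<rightarrow>\<^sup>*\<^bsub>with_proj T\<^esub> w"
proof -
  interpret pair_graph T using assms(1) unfolding undirected_tree_def by blast
  have "strongly_connected (with_proj T)"
    using assms(1) pair_sym_arcs symmetric_connected_imp_strongly_connected
    unfolding undirected_tree_def by blast
  then show ?thesis using assms(2,3) unfolding strongly_connected_def by simp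
qed

text \<open>A walk from \<open>a\<close> to \<open>b\<close> missing \<open>v\<close> would close up
  through \<open>v\<close> to a cycle.\<close>

lemma undirected_tree_neighbors_separated:
  assumes "undirected_tree T" "(v, a) \<in> parcs T" "(v, b) \<in> parcs T" "a \<noteq> b"
  shows "\<not> pair_pre_digraph.connected_avoiding T v a b"
proof -
  interpret pair_graph T using assms(1) unfolding undirected_tree_def by blast
  show ?thesis
  proof
    assume "connected_avoiding v a b"
    then obtain p where p: "awalk a p b" "v \<notin> set (awalk_verts a p)"
      unfolding connected_avoiding_def by blast
    \<comment> \<open>Shortening to a path makes the vertices distinct and adds none, so
      \<open>v\<close> is still missed.\<close>
    define q where "q = awalk_to_apath p"
    have q: "apath a q b"
      using p(1) apath_awalk_to_apath unfolding q_def by blast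
    then have aq: "awalk a q b" by (simp add: apath_def)
    have vq: "v \<notin> set (awalk_verts a q)"
      using p awalk_to_apath_subset[OF p(1)] set_awalk_verts[OF p(1)] set_awalk_verts[OF aq]
      unfolding q_def by auto
    \<comment> \<open>Together with the two arcs at \<open>v\<close> this gives length at least 3,
      so the cycle is not just an edge traversed back and forth.\<close>
    have "q \<noteq> []" using aq assms(4) by (auto simp: awalk_Nil_iff)
    have bv: "(b, v) \<in> parcs T" using assms(3) arcs_symmetric by blast
    have walk: "awalk v ((v, a) # q @ [(b, v)]) v"
      using aq assms(2) bv by (auto simp: awalk_simps intro: in_arcsD1 in_arcsD2)
    have "awalk_verts a (q @ [(b, v)]) = awalk_verts a q @ [v]"
      using awalk_verts_append[of a q "[(b, v)]" v] walk aq by (simp add: awalk_Cons_iff)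
    then have "distinct (tl (awalk_verts v ((v, a) # q @ [(b, v)])))"
      using q vq by (simp add: apath_def)
    with walk have "cycle ((v, a) # q @ [(b, v)])" unfolding cycle_def by blast
    moreover have "length ((v, a) # q @ [(b, v)]) \<ge> 3" using \<open>q \<noteq> []\<close> by (cases q) auto
    ultimately show False using assms(1) unfolding undirected_tree_def by blast
  qed
qed

lemma undirected_tree_inner_vertex_if_separated:
  assumes "undirected_tree T" "u \<in> pverts T" "w \<in> pverts T" "u \<noteq> v" "w \<noteq> v"
    and "\<not> pair_pre_digraph.connected_avoiding T v u w"
  obtains p where "pre_digraph.apath (with_proj T) u p w"
    "v \<in> set (pre_digraph.inner_verts (with_proj T) p)"
proof -
  interpret pair_graph T using assms(1) unfolding undirected_tree_def by blast
  obtain p where p: "apath u p w"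
    using undirected_tree_reachable[OF assms(1-3)] reachable_apath by blast
  moreover have "v \<in> set (awalk_verts u p)"
    using p assms(6) unfolding connected_avoiding_def apath_def by blast
  ultimately show ?thesis using that set_inner_verts[OF p] assms(4,5) by simp
qed

lemma cist_undirected_tree:
  assumes "completely_independent_spanning_trees G k T" "i \<in> {1..k}"
  shows "undirected_tree (T i)" "pverts (T i) = pverts G" "parcs (T i) \<subseteq> parcs G"
  using assms
  unfolding completely_independent_spanning_trees_def undirected_spanning_tree_def
    spanning_def subgraph_def by auto

text \<open>A shared arc would be a one-edge path between its ends in both trees. It has no inner
  vertices, so the contradiction comes from edge-disjointness.\<close>

lemma cist_arc_disjoint:
  assumes "completely_independent_spanning_trees G k T"
    and "i \<in> {1..k}" "j \<in> {1..k}" "i \<noteq> j" "(x, y) \<in> parcs (T i)"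
  shows "(x, y) \<notin> parcs (T j)"
proof
  assume xy: "(x, y) \<in> parcs (T j)"
  interpret Ti: pair_graph "T i"
    using cist_undirected_tree(1)[OF assms(1,2)] unfolding undirected_tree_def by blast
  interpret Tj: pair_graph "T j"
    using cist_undirected_tree(1)[OF assms(1,3)] unfolding undirected_tree_def by blast
  have V: "x \<in> pverts G" "y \<in> pverts G"
    using cist_undirected_tree(2)[OF assms(1,2)] Ti.in_arcsD1 Ti.in_arcsD2 assms(5) by blast+
  have "x \<noteq> y" using Ti.no_loops' assms(5) by blast
  have "Ti.apath x [(x, y)] y" "Tj.apath x [(x, y)] y"
    using assms(5) xy \<open>x \<noteq> y\<close>
    by (auto simp: Ti.apath_simps Tj.apath_simps dest: Ti.in_arcsD2 Tj.in_arcsD2)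
  then have "undirected_edges [(x, y)] \<inter> undirected_edges [(x, y)] = {}"
    using assms(1-4) V unfolding completely_independent_spanning_trees_def by blast
  then show False by (simp add: undirected_edges_def)
qed

lemma cist_internal_vertex_unique:
  assumes "completely_independent_spanning_trees G k T"
    and "i \<in> {1..k}" "j \<in> {1..k}" "internal_vertex (T i) v" "internal_vertex (T j) v"
  shows "i = j"
proof (rule ccontr)
  assume "i \<noteq> j"
  note ti = cist_undirected_tree[OF assms(1,2)] and tj = cist_undirected_tree[OF assms(1,3)]
  interpret Ti: pair_graph "T i" using ti(1) unfolding undirected_tree_def by blast
  interpret Tj: pair_graph "T j" using tj(1) unfolding undirected_tree_def by blast
  obtain a b where ab: "a \<noteq> b" "(v, a) \<in> parcs (T i)" "(v, b) \<in> parcs (T i)"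
    using assms(4) unfolding internal_vertex_def by blast
  obtain c d where cd: "c \<noteq> d" "(v, c) \<in> parcs (T j)" "(v, d) \<in> parcs (T j)"
    using assms(5) unfolding internal_vertex_def by blast
  have sep_ab: "\<not> Ti.connected_avoiding v a b"
    using undirected_tree_neighbors_separated[OF ti(1) ab(2,3,1)] .
  have sep_cd: "\<not> Tj.connected_avoiding v c d"
    using undirected_tree_neighbors_separated[OF tj(1) cd(2,3,1)] .
  \<comment> \<open>Four neighbours of \<open>v\<close> suffice to find a pair separated by
    \<open>v\<close> in both trees.\<close>
  have "\<exists>x\<in>{a, b, c, d}. \<exists>y\<in>{a, b, c, d}.
      \<not> Ti.connected_avoiding v x y \<and> \<not> Tj.connected_avoiding v x y"
  proof (cases "Tj.connected_avoiding v a b")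
    case False
    then show ?thesis using sep_ab by blast
  next
    case True
    \<comment> \<open>As \<open>c\<close> and \<open>d\<close> are separated in \<open>T j\<close>,
      one of them, \<open>e\<close>, lies outside the common component of \<open>a\<close> and
      \<open>b\<close>. In \<open>T i\<close>, \<open>e\<close> cannot be joined to both
      \<open>a\<close> and \<open>b\<close>, so one of these two forms the required pair with
      \<open>e\<close>.\<close>
    have "\<not> Tj.connected_avoiding v a c \<or> \<not> Tj.connected_avoiding v a d"
      using sep_cd Tj.connected_avoiding_trans[OF Tj.connected_avoiding_sym, of v a c d] by blast
    then obtain e where e: "e \<in> {c, d}" "\<not> Tj.connected_avoiding v a e" by blast
    then have "\<not> Tj.connected_avoiding v b e"
      using Tj.connected_avoiding_trans[OF True] by blast
    moreover have "\<not> Ti.connected_avoiding v a e \<or> \<not> Ti.connected_avoiding v b e"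
      using sep_ab Ti.connected_avoiding_trans[of v a e b] Ti.connected_avoiding_sym[of v b e]
      by blast
    ultimately show ?thesis using e by blast
  qed
  then obtain x y where xy: "x \<in> {a, b, c, d}" "y \<in> {a, b, c, d}"
    and sep: "\<not> Ti.connected_avoiding v x y" "\<not> Tj.connected_avoiding v x y" by blast
  have nbr: "u \<in> pverts G \<and> u \<noteq> v" if "u \<in> {a, b, c, d}" for u
  proof -
    have "(v, u) \<in> parcs (T i) \<or> (v, u) \<in> parcs (T j)" using that ab cd by auto
    then show ?thesis
      using Ti.in_arcsD2[of v u] Tj.in_arcsD2[of v u] Ti.no_loops'[of v u] Tj.no_loops'[of v u]
        ti(2) tj(2) by auto
  qed
  have V: "x \<in> pverts G" "x \<noteq> v" "y \<in> pverts G" "y \<noteq> v"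
    using nbr xy by blast+
  obtain p where p: "Ti.apath x p y" "v \<in> set (Ti.inner_verts p)"
    using undirected_tree_inner_vertex_if_separated[OF ti(1) _ _ V(2,4) sep(1)] V ti(2)
    by auto
  obtain q where q: "Tj.apath x q y" "v \<in> set (Tj.inner_verts q)"
    using undirected_tree_inner_vertex_if_separated[OF tj(1) _ _ V(2,4) sep(2)] V tj(2)
    by auto
  have "set (Ti.inner_verts p) \<inter> set (Tj.inner_verts q) = {}"
    using assms(1-3) \<open>i \<noteq> j\<close> V(1,3) p(1) q(1)
    unfolding completely_independent_spanning_trees_def by blast
  then show False using p(2) q(2) by blast
qed

text \<open>A neighbour of \<open>x\<close> that is not internal is adjacent only to
  \<open>x\<close>, so by induction no walk from \<open>x\<close> leaves \<open>x\<close> and its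
  neighbours.\<close>

lemma undirected_tree_star:
  assumes "undirected_tree T" "x \<in> pverts T" "y \<in> pverts T" "y \<noteq> x"
    and "\<And>z. (x, z) \<in> parcs T \<Longrightarrow> \<not> internal_vertex T z"
  shows "(x, y) \<in> parcs T"
proof -
  interpret pair_graph T using assms(1) unfolding undirected_tree_def by blast
  have "y = x \<or> (x, y) \<in> parcs T"
    using undirected_tree_reachable[OF assms(1-3)]
  proof (induction rule: reachable_induct)
    case (step u w)
    then show ?case
      using assms(5)[of u] arcs_symmetric[of x u] unfolding internal_vertex_def by auto
  qed simp
  with assms(4) show ?thesis by blast
qed

lemma cist_internal_neighbor:
  assumes "completely_independent_spanning_trees G k T" "k \<ge> 2" "i \<in> {1..k}"
    and "x \<in> pverts G" "y \<in> pverts G" "x \<noteq> y"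
  obtains z where "(x, z) \<in> parcs (T i)" "internal_vertex (T i) z"
proof (rule ccontr)
  assume "\<not> thesis"
  then have leaves: "\<And>z. (x, z) \<in> parcs (T i) \<Longrightarrow> \<not> internal_vertex (T i) z"
    using that by blast
  \<comment> \<open>The index of a second tree; it is in range because
    \<open>k \<ge> 2\<close>.\<close>
  define j where "j = (if i = 1 then 2 else 1 :: nat)"
  have j: "j \<in> {1..k}" "i \<noteq> j" using assms(2) by (auto simp: j_def)
  note ti = cist_undirected_tree[OF assms(1,3)] and tj = cist_undirected_tree[OF assms(1) j(1)]
  interpret Tj: pair_graph "T j" using tj(1) unfolding undirected_tree_def by blast
  have "x \<rightarrow>\<^sup>*\<^bsub>with_proj (T j)\<^esub> y"
    using undirected_tree_reachable[OF tj(1)] tj(2) assms(4,5) by simp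
  \<comment> \<open>The first arc of a walk to \<open>y\<close>, which exists since \<open>y\<close>
    differs from \<open>x\<close>.\<close>
  then obtain z where z: "(x, z) \<in> parcs (T j)"
    using assms(6) by (cases rule: Tj.converse_reachable_cases) auto
  then have "(x, z) \<in> parcs (T i)"
    using undirected_tree_star[OF ti(1) _ _ _ leaves] assms(4) ti(2) tj(2)
      Tj.in_arcsD2 Tj.no_loops' by metis
  then show False using z cist_arc_disjoint[OF assms(1,3) j] by blast
qed

theorem theorem4:
  fixes G :: "'a pair_pre_digraph" and D I :: "'a set" and k :: nat
  assumes "k \<ge> 2"
    and "split_graph G D I"
    and "\<forall>v\<in>D. \<exists>x\<in>I. (v, x) \<in> parcs G"
    and "\<exists>T. completely_independent_spanning_trees G k T"
  shows "\<exists>c. panchromatic_coloring k (split_hypergraph G D I) c"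
proof -
  obtain T where T: "completely_independent_spanning_trees G k T" using assms(4) by blast
  have V: "pverts G = D \<union> I" "D \<inter> I = {}" "D \<noteq> {}"
    using assms(2) unfolding split_graph_def by blast+
  \<comment> \<open>The choice is from at most one index by
    \<open>cist_internal_vertex_unique\<close>. The default 1 only keeps vertices internal in no
    tree within the colour range.\<close>
  define c where
    "c v = (if \<exists>i\<in>{1..k}. internal_vertex (T i) v
            then SOME i. i \<in> {1..k} \<and> internal_vertex (T i) v else 1)" for v
  have c_eq: "c v = i" if "i \<in> {1..k}" "internal_vertex (T i) v" for i v
  proof -
    have "(SOME i. i \<in> {1..k} \<and> internal_vertex (T i) v) = i"
      using that cist_internal_vertex_unique[OF T] by (intro some_equality) auto
    then show ?thesis using that unfolding c_def by auto
  qed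
  have c_range: "c v \<in> {1..k}" for v
    using c_eq[of _ v] assms(1) by (cases "\<exists>i\<in>{1..k}. internal_vertex (T i) v") (auto simp: c_def)
  have "\<exists>v\<in>neighborhood G x. c v = i" if x: "x \<in> I" and i: "i \<in> {1..k}" for x i
  proof -
    \<comment> \<open>Any element of the nonempty \<open>D\<close> serves, being outside
      \<open>I\<close>.\<close>
    obtain d where "d \<in> pverts G" "x \<noteq> d" using V x by blast
    then obtain z where z: "(x, z) \<in> parcs (T i)" "internal_vertex (T i) z"
      using cist_internal_neighbor[OF T assms(1) i] V(1) x by blast
    \<comment> \<open>Arcs of \<open>T i\<close> are arcs of \<open>G\<close>, so \<open>z\<close>
      lies in the hyperedge of \<open>x\<close> and has colour \<open>i\<close>.\<close>
    then show ?thesis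
      using c_eq[OF i] cist_undirected_tree(3)[OF T i] unfolding neighborhood_def by blast
  qed
  then have "panchromatic_coloring k (split_hypergraph G D I) c"
    using c_range unfolding panchromatic_coloring_def split_hypergraph_def by auto
  then show ?thesis by blast
qed

end
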